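(* Let $\{c_n\}_{n=1}^{\infty}$ be a sequence of complex numbers such that $\sum_{n=1}^{\infty}|c_n|$ is convergent. Then the limit $$\mathop{\mathcal{R}}_{n=1}^{\infty}\left(z+c_nz^2\right) = \lim_{N\to\infty}\mathop{\mathcal{R}}_{n=1}^{N}\left(z+c_nz^2\right)$$ converges uniformly on every compact subset of $\mathbb{C}$, and it defines an entire function.
   Context: For integers $N\ge d$ and functions $f_d,\ldots,f_N$, the finite composition is $\mathop{\mathcal{R}}_{n=d}^{N} f_n(z) := f_d(f_{d+1}(\cdots f_{N-1}(f_N(z))\cdots))$ (the function with the largest index is applied first). Here it is applied to $f_n(z)=z+c_nz^2$. *)

theory Defs
  imports "HOL-Complex_Analysis.Complex_Analysis"
begin

(* f d \<circ> f (d+1) \<circ> ... \<circ> f N: the function with the largest index is applied first.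
   Only N \<ge> d is meaningful; for N < d this is the identity. *)
definition fin_comp :: "(nat \<Rightarrow> 'a \<Rightarrow> 'a) \<Rightarrow> nat \<Rightarrow> nat \<Rightarrow> 'a \<Rightarrow> 'a" where
  "fin_comp f d N = foldr (\<lambda>n g. f n \<circ> g) [d..<Suc N] id"

(* Pointwise limit; it has an unspecified value wherever the finite compositions
   do not converge, so convergence has to be asserted separately. *)
definition inf_comp :: "(nat \<Rightarrow> 'a \<Rightarrow> 'a) \<Rightarrow> nat \<Rightarrow> 'a \<Rightarrow> 'a::t2_space" where
  "inf_comp f d z = lim (\<lambda>N. fin_comp f d N z)"

end

theory Submission
  imports Defs
begin

text \<open>
  Only the part of the composition with large indices is delicate. On the disc of radius \<open>2 * R\<close>
  each factor \<open>z + c n * z\<^sup>2\<close> moves points by at most \<open>4 * R\<^sup>2 * norm (c n)\<close> and is Lipschitz with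
  constant \<open>1 + 4 * R * norm (c n)\<close>. Hence, if the coefficients of a block are so small that
  \<open>4 * R\<close> times the sum of their moduli is at most \<open>1\<close>, an orbit that starts in the disc of radius
  \<open>R\<close> never leaves the disc of radius \<open>2 * R\<close>; the composition of the block then moves points by
  at most \<open>4 * R\<^sup>2\<close> times that sum (\<open>norm_quadratic_comp_diff_le\<close>), and its Lipschitz constant on
  the disc of radius \<open>R\<close> is at most \<open>exp 1\<close>, however long the block is
  (\<open>quadratic_comp_lipschitz\<close>).

  Write \<open>G N\<close> for the composition of the factors from a fixed late index up to \<open>N\<close>. The index is
  chosen so late that both facts also hold with \<open>2 * R\<close> in place of \<open>R\<close>. For \<open>m < n\<close>
  the map \<open>G n\<close> is \<open>G m\<close> after a further block \<open>H\<close>, so \<open>G n z\<close> and \<open>G m z\<close> are the images under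
  one and the same Lipschitz map \<open>G m\<close> of \<open>H z\<close> and of \<open>z\<close>, and these two points are close by the
  displacement bound. This makes \<open>G\<close> uniformly Cauchy on the disc of radius \<open>R\<close>. The finitely many
  remaining factors form a polynomial, which is uniformly continuous on the disc of radius \<open>2 * R\<close>
  and therefore preserves uniform convergence. Locally uniform limits of holomorphic functions are
  holomorphic, so the limit is entire.
\<close>

section \<open>Finite compositions\<close>

lemma fin_comp_empty: "fin_comp f (Suc N) N = id"
  by (simp add: fin_comp_def)

lemma fin_comp_rec: "d \<le> N \<Longrightarrow> fin_comp f d N z = f d (fin_comp f (Suc d) N z)"
  by (simp add: fin_comp_def upt_conv_Cons del: upt_Suc)

lemma fin_comp_split:
  assumes "d \<le> Suc m" "m \<le> N"
  shows "fin_comp f d N z = fin_comp f d m (fin_comp f (Suc m) N z)"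
  using assms(1)
proof (induction rule: inc_induct)
  case base
  show ?case by (simp add: fin_comp_empty)
next
  case (step d)
  then show ?case using assms(2) by (simp add: fin_comp_rec)
qed

lemma fin_comp_holomorphic:
  assumes "\<And>n. f n holomorphic_on UNIV"
  shows "fin_comp f d N holomorphic_on UNIV"
proof -
  have "foldr (\<lambda>n g. f n \<circ> g) xs id holomorphic_on UNIV" for xs
  proof (induction xs)
    case Nil
    show ?case by (simp add: id_def)
  next
    case (Cons n xs)
    have "f n \<circ> foldr (\<lambda>n g. f n \<circ> g) xs id holomorphic_on UNIV"
      using Cons.IH assms by (rule holomorphic_on_compose_gen) simp
    then show ?case by (simp add: comp_def id_def)
  qed
  then show ?thesis by (simp add: fin_comp_def)
qed

section \<open>Blocks with small coefficients\<close>

text \<open>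
  As long as the orbit stays in the disc of radius \<open>2 * R\<close>, the factor with index \<open>n\<close> displaces it
  by at most \<open>norm (c n) * (2 * R)\<^sup>2\<close>. The smallness assumption bounds the sum of these
  displacements by \<open>R\<close>, which in turn keeps the orbit in that disc.
\<close>

lemma norm_quadratic_comp_diff_le:
  fixes c :: "nat \<Rightarrow> 'a::real_normed_field"
  assumes z: "norm z \<le> R" and "d \<le> Suc N"
    and small: "4 * R * (\<Sum>n\<in>{d..<Suc N}. norm (c n)) \<le> 1"
  shows "norm (fin_comp (\<lambda>n z. z + c n * z\<^sup>2) d N z - z)
           \<le> 4 * R\<^sup>2 * (\<Sum>n\<in>{d..<Suc N}. norm (c n))"
  using assms(2) small
proof (induction rule: inc_induct)
  case base
  show ?case by (simp add: fin_comp_empty)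
next
  case (step d)
  let ?S = "\<lambda>d. \<Sum>n\<in>{d..<Suc N}. norm (c n)"
  define u where "u = fin_comp (\<lambda>n z. z + c n * z\<^sup>2) (Suc d) N z"
  have R: "0 \<le> R" using z norm_ge_zero[of z] by linarith
  have S: "?S d = norm (c d) + ?S (Suc d)"
    using step.hyps by (simp add: sum.atLeast_Suc_lessThan del: sum.op_ivl_Suc)
  have "4 * R * ?S (Suc d) \<le> 4 * R * ?S d"
    using R S by (intro mult_left_mono) auto
  then have small': "4 * R * ?S (Suc d) \<le> 1"
    using step.prems by linarith
  then have IH: "norm (u - z) \<le> 4 * R\<^sup>2 * ?S (Suc d)"
    unfolding u_def by (rule step.IH)
  have "R * (4 * R * ?S (Suc d)) \<le> R * 1"
    using small' R by (rule mult_left_mono)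
  then have "norm (u - z) \<le> R"
    using IH by (simp add: power2_eq_square mult_ac)
  then have "norm u \<le> 2 * R"
    using z norm_triangle_sub[of u z] by linarith
  then have "norm u ^ 2 \<le> (2 * R) ^ 2"
    by (rule power_mono) simp
  then have "norm (c d) * norm u ^ 2 \<le> norm (c d) * (2 * R) ^ 2"
    by (rule mult_left_mono) simp
  then have step_le: "norm (c d * u\<^sup>2) \<le> 4 * R\<^sup>2 * norm (c d)"
    by (simp add: norm_mult norm_power power_mult_distrib mult_ac)
  have "norm (u + c d * u\<^sup>2 - z) \<le> norm (u - z) + norm (c d * u\<^sup>2)"
    using norm_triangle_ineq[of "u - z" "c d * u\<^sup>2"] by (simp add: algebra_simps)
  also have "\<dots> \<le> 4 * R\<^sup>2 * ?S d"
    using IH step_le unfolding S by (simp add: distrib_left)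
  finally show ?case
    using step.hyps by (simp add: fin_comp_rec u_def)
qed

lemma norm_quadratic_comp_le:
  fixes c :: "nat \<Rightarrow> 'a::real_normed_field"
  assumes z: "norm z \<le> R" and "d \<le> Suc N"
    and small: "4 * R * (\<Sum>n\<in>{d..<Suc N}. norm (c n)) \<le> 1"
  shows "norm (fin_comp (\<lambda>n z. z + c n * z\<^sup>2) d N z) \<le> 2 * R"
proof -
  let ?S = "\<Sum>n\<in>{d..<Suc N}. norm (c n)"
  let ?u = "fin_comp (\<lambda>n z. z + c n * z\<^sup>2) d N z"
  have R: "0 \<le> R" using z norm_ge_zero[of z] by linarith
  have "R * (4 * R * ?S) \<le> R * 1"
    using small R by (rule mult_left_mono)
  then have "norm (?u - z) \<le> R"
    using norm_quadratic_comp_diff_le[OF assms] by (simp add: power2_eq_square mult_ac)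
  then show ?thesis
    using z norm_triangle_sub[of ?u z] by linarith
qed

text \<open>
  The difference quotient of \<open>z + c n * z\<^sup>2\<close> at two points \<open>u\<close>, \<open>v\<close> of the disc of radius \<open>2 * R\<close> is
  \<open>1 + c n * (u + v)\<close>, of modulus at most \<open>1 + 4 * R * norm (c n)\<close>. The product of these bounds
  over a block is at most the exponential of \<open>4 * R\<close> times the sum of the \<open>norm (c n)\<close>, and so does
  not grow with the length of the block.
\<close>

lemma quadratic_comp_lipschitz:
  fixes c :: "nat \<Rightarrow> 'a::real_normed_field"
  assumes z: "norm z \<le> R" and w: "norm w \<le> R" and "d \<le> Suc N"
    and small: "4 * R * (\<Sum>n\<in>{d..<Suc N}. norm (c n)) \<le> 1"
  shows "norm (fin_comp (\<lambda>n z. z + c n * z\<^sup>2) d N z - fin_comp (\<lambda>n z. z + c n * z\<^sup>2) d N w)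
           \<le> exp (4 * R * (\<Sum>n\<in>{d..<Suc N}. norm (c n))) * norm (z - w)"
  using assms(3) small
proof (induction rule: inc_induct)
  case base
  show ?case by (simp add: fin_comp_empty)
next
  case (step d)
  let ?S = "\<lambda>d. \<Sum>n\<in>{d..<Suc N}. norm (c n)"
  define u where "u = fin_comp (\<lambda>n z. z + c n * z\<^sup>2) (Suc d) N z"
  define v where "v = fin_comp (\<lambda>n z. z + c n * z\<^sup>2) (Suc d) N w"
  have R: "0 \<le> R" using z norm_ge_zero[of z] by linarith
  have S: "?S d = norm (c d) + ?S (Suc d)"
    using step.hyps by (simp add: sum.atLeast_Suc_lessThan del: sum.op_ivl_Suc)
  have "4 * R * ?S (Suc d) \<le> 4 * R * ?S d"
    using R S by (intro mult_left_mono) auto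
  then have small': "4 * R * ?S (Suc d) \<le> 1"
    using step.prems by linarith
  then have IH: "norm (u - v) \<le> exp (4 * R * ?S (Suc d)) * norm (z - w)"
    unfolding u_def v_def by (rule step.IH)
  have "norm u \<le> 2 * R" "norm v \<le> 2 * R"
    unfolding u_def v_def using z w small' step.hyps
    by (auto intro!: norm_quadratic_comp_le)
  then have "norm (u + v) \<le> 4 * R"
    using norm_triangle_ineq[of u v] by linarith
  then have "norm (c d) * norm (u + v) \<le> norm (c d) * (4 * R)"
    by (rule mult_left_mono) simp
  then have "norm (1 + c d * (u + v)) \<le> 1 + 4 * R * norm (c d)"
    using norm_triangle_ineq[of 1 "c d * (u + v)"] by (simp add: norm_mult mult_ac)
  also have "\<dots> \<le> exp (4 * R * norm (c d))"
    by (rule exp_ge_add_one_self)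
  finally have factor: "norm (1 + c d * (u + v)) \<le> exp (4 * R * norm (c d))" .
  have "(u + c d * u\<^sup>2) - (v + c d * v\<^sup>2) = (1 + c d * (u + v)) * (u - v)"
    by (simp add: algebra_simps power2_eq_square)
  then have "norm ((u + c d * u\<^sup>2) - (v + c d * v\<^sup>2))
      = norm (1 + c d * (u + v)) * norm (u - v)"
    by (simp add: norm_mult)
  also have "\<dots> \<le> exp (4 * R * norm (c d)) * (exp (4 * R * ?S (Suc d)) * norm (z - w))"
    using factor IH by (intro mult_mono) auto
  also have "\<dots> = exp (4 * R * ?S d) * norm (z - w)"
    unfolding S by (simp add: distrib_left exp_add)
  finally show ?case
    using step.hyps by (simp add: fin_comp_rec u_def v_def)
qed

section \<open>Uniform convergence\<close>

lemma summable_norm_Cauchy: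
  fixes c :: "nat \<Rightarrow> 'a::real_normed_vector"
  assumes "summable (\<lambda>n. norm (c n))" "0 < e"
  obtains M where "\<And>m n. M \<le> m \<Longrightarrow> (\<Sum>k\<in>{m..<n}. norm (c k)) < e"
proof -
  obtain M where M: "\<forall>m\<ge>M. \<forall>n. norm (\<Sum>k\<in>{m..<n}. norm (c k)) < e"
    using assms unfolding summable_Cauchy by blast
  show thesis
  proof (rule that)
    show "(\<Sum>k\<in>{m..<n}. norm (c k)) < e" if "M \<le> m" for m n
      using M that abs_ge_self[of "\<Sum>k\<in>{m..<n}. norm (c k)"]
      by (auto intro: le_less_trans)
  qed
qed

text \<open>
  The limit of a tail is obtained by the Cauchy criterion. The smallness condition is imposed with
  \<open>8 * R\<close> since the Lipschitz bound for the outer block is needed on the disc of radius \<open>2 * R\<close>,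
  where the inner block may move its argument.
\<close>

lemma quadratic_comp_uniformly_Cauchy:
  fixes c :: "nat \<Rightarrow> 'a::{real_normed_field,banach}"
  assumes "0 \<le> R" and summable: "summable (\<lambda>n. norm (c n))"
    and small: "\<And>m n. d \<le> m \<Longrightarrow> 8 * R * (\<Sum>k\<in>{m..<n}. norm (c k)) \<le> 1"
  shows "uniformly_Cauchy_on (cball 0 R) (fin_comp (\<lambda>n z. z + c n * z\<^sup>2) d)"
proof (rule uniformly_Cauchy_onI')
  fix e :: real
  assume "0 < e"
  let ?G = "fin_comp (\<lambda>n z. z + c n * z\<^sup>2)"
  define L where "L = exp 1 * (4 * R\<^sup>2) + 1"
  have L: "0 < L" unfolding L_def by (intro add_nonneg_pos) auto
  obtain M where M: "\<And>m n. M \<le> m \<Longrightarrow> (\<Sum>k\<in>{m..<n}. norm (c k)) < e / L"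
    using summable_norm_Cauchy[OF summable, of "e / L"] \<open>0 < e\<close> L by auto
  have "dist (?G d m z) (?G d n z) < e"
    if z: "z \<in> cball 0 R" and m: "max d M \<le> m" and "m < n" for z m n
  proof -
    let ?T = "\<Sum>k\<in>{Suc m..<Suc n}. norm (c k)"
    define w where "w = ?G (Suc m) n z"
    have T0: "0 \<le> ?T" by (simp add: sum_nonneg)
    have T: "8 * R * ?T \<le> 1" "?T < e / L"
      using m small[of "Suc m" "Suc n"] M[of "Suc m" "Suc n"] by auto
    have zR: "norm z \<le> R" using z by simp
    have "4 * R * ?T \<le> 8 * R * ?T"
      using \<open>0 \<le> R\<close> T0 by (intro mult_right_mono) auto
    then have T': "4 * R * ?T \<le> 1" using T(1) by linarith
    have mn: "Suc m \<le> Suc n" using \<open>m < n\<close> by simp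
    have w: "norm w \<le> 2 * R" "norm (w - z) \<le> 4 * R\<^sup>2 * ?T"
      unfolding w_def
      using norm_quadratic_comp_le[OF zR mn T'] norm_quadratic_comp_diff_le[OF zR mn T'] .
    have outer: "4 * (2 * R) * (\<Sum>k\<in>{d..<Suc m}. norm (c k)) \<le> 1"
      using small[of d "Suc m"] by simp
    have "norm (?G d m z - ?G d m w)
        \<le> exp (4 * (2 * R) * (\<Sum>k\<in>{d..<Suc m}. norm (c k))) * norm (z - w)"
      using zR \<open>0 \<le> R\<close> w(1) m outer by (intro quadratic_comp_lipschitz) auto
    also have "\<dots> \<le> exp 1 * (4 * R\<^sup>2 * ?T)"
      using outer w(2) by (intro mult_mono) (auto simp: norm_minus_commute)
    also have "\<dots> \<le> L * ?T"
      using T0 by (simp add: L_def algebra_simps)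
    also have "\<dots> < e"
      using T(2) L by (simp add: field_simps)
    finally have "dist (?G d m z) (?G d m w) < e"
      by (simp add: dist_norm)
    moreover have "?G d n z = ?G d m w"
      unfolding w_def using m \<open>m < n\<close> by (intro fin_comp_split) auto
    ultimately show ?thesis by simp
  qed
  then show "\<exists>M. \<forall>z\<in>cball 0 R. \<forall>m\<ge>M. \<forall>n>m. dist (?G d m z) (?G d n z) < e"
    by blast
qed

lemma quadratic_comp_uniformly_convergent:
  fixes c :: "nat \<Rightarrow> complex"
  assumes summable: "summable (\<lambda>n. norm (c n))" and "compact K"
  shows "uniformly_convergent_on K (fin_comp (\<lambda>n z. z + c n * z\<^sup>2) d)"
proof -
  let ?G = "fin_comp (\<lambda>n z. z + c n * z\<^sup>2)"
  obtain R where "0 < R" and KR: "K \<subseteq> cball 0 R"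
    using compact_imp_bounded[OF \<open>compact K\<close>] bounded_pos[of K] by (auto simp: subset_iff)
  obtain M0 where M0: "\<And>m n. M0 \<le> m \<Longrightarrow> (\<Sum>k\<in>{m..<n}. norm (c k)) < 1 / (8 * R)"
    using summable_norm_Cauchy[OF summable, of "1 / (8 * R)"] \<open>0 < R\<close> by auto
  define M where "M = max d M0"
  have small: "8 * R * (\<Sum>k\<in>{m..<n}. norm (c k)) \<le> 1" if "Suc M \<le> m" for m n
  proof -
    have "(\<Sum>k\<in>{m..<n}. norm (c k)) < 1 / (8 * R)"
      using that by (intro M0) (simp add: M_def)
    then show ?thesis
      using \<open>0 < R\<close> by (simp add: field_simps)
  qed
  have tail: "uniformly_convergent_on (cball 0 R) (?G (Suc M))"
    using quadratic_comp_uniformly_Cauchy[OF _ summable small] \<open>0 < R\<close>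
    by (simp add: uniformly_convergent_eq_Cauchy)
  have "uniformly_convergent_on (cball 0 R) (\<lambda>N z. ?G d M (?G (Suc M) N z))"
  proof (rule uniformly_convergent_on_compose_uniformly_continuous_on[OF tail])
    have "?G d M holomorphic_on UNIV"
      by (intro fin_comp_holomorphic holomorphic_intros)
    then show "uniformly_continuous_on (cball 0 (2 * R)) (?G d M)"
      by (intro compact_uniformly_continuous compact_cball)
        (auto intro: holomorphic_on_imp_continuous_on holomorphic_on_subset)
    have "norm (?G (Suc M) N z) \<le> 2 * R" if "M \<le> N" "norm z \<le> R" for N z
    proof (rule norm_quadratic_comp_le)
      have "4 * R * (\<Sum>k\<in>{Suc M..<Suc N}. norm (c k))
          \<le> 8 * R * (\<Sum>k\<in>{Suc M..<Suc N}. norm (c k))"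
        using \<open>0 < R\<close> by (intro mult_right_mono sum_nonneg) auto
      then show "4 * R * (\<Sum>k\<in>{Suc M..<Suc N}. norm (c k)) \<le> 1"
        using small[of "Suc M" "Suc N"] by linarith
    qed (use that in auto)
    then show "\<forall>\<^sub>F N in sequentially. \<forall>z\<in>cball 0 R. ?G (Suc M) N z \<in> cball 0 (2 * R)"
      unfolding eventually_sequentially by (intro exI[of _ M]) simp
  qed auto
  moreover have "\<forall>\<^sub>F N in sequentially. \<forall>z\<in>cball 0 R. ?G d M (?G (Suc M) N z) = ?G d N z"
    unfolding eventually_sequentially
  proof (intro exI allI impI ballI)
    show "?G d M (?G (Suc M) N z) = ?G d N z" if "M \<le> N" for N z
      using that by (intro fin_comp_split[symmetric]) (auto simp: M_def)
  qed
  ultimately have "uniformly_convergent_on (cball 0 R) (?G d)"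
    by (subst (asm) uniformly_convergent_cong[OF _ refl])
  then show ?thesis
    using KR by (rule uniformly_convergent_on_subset)
qed

theorem corollary1p1:
  fixes c :: "nat \<Rightarrow> complex"
  assumes "summable (\<lambda>n. cmod (c (Suc n)))"
  shows "(\<forall>K. compact K \<longrightarrow>
            uniform_limit K (\<lambda>N. fin_comp (\<lambda>n z. z + c n * z\<^sup>2) 1 N)
              (inf_comp (\<lambda>n z. z + c n * z\<^sup>2) 1) sequentially)
       \<and> inf_comp (\<lambda>n z. z + c n * z\<^sup>2) 1 holomorphic_on UNIV"
proof -
  let ?f = "\<lambda>n z. z + c n * z\<^sup>2"
  have "summable (\<lambda>n. norm (c n))"
    using assms by (subst (asm) summable_Suc_iff)
  then have lim: "uniform_limit K (fin_comp ?f 1) (inf_comp ?f 1) sequentially"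
    if "compact K" for K
    using quadratic_comp_uniformly_convergent[of c K 1] that
    by (simp add: uniformly_convergent_uniform_limit_iff inf_comp_def[abs_def])
  have "inf_comp ?f 1 holomorphic_on UNIV"
  proof (rule holomorphic_uniform_sequence)
    show "fin_comp ?f 1 N holomorphic_on UNIV" for N
      by (intro fin_comp_holomorphic holomorphic_intros)
    show "\<exists>r>0. cball z r \<subseteq> UNIV \<and> uniform_limit (cball z r) (fin_comp ?f 1) (inf_comp ?f 1) sequentially"
      for z
      using lim[of "cball z 1"] by (intro exI[of _ 1]) auto
  qed auto
  with lim show ?thesis by blast
qed

end
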